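(* Let $p\in[-1,1]$, $p\neq 0$. For any initial point $x^{(0)}=(x_1^{(0)},x_2^{(0)},1-x_1^{(0)}-x_2^{(0)},0,0)\in S^4$ whose first three coordinates are all non-zero and with $(x_1^{(0)},x_2^{(0)},1-x_1^{(0)}-x_2^{(0)})\neq(\frac13,\frac13,\frac13)$, the set of limit points of the trajectory $\{W^n(x^{(0)})\}_{n\ge0}$ is infinite and lies on the one-dimensional boundary of $S^4$.
   Context: $S^4=\{x=(x_1,\dots,x_5)\in\mathbb{R}^5: x_i\ge 0,\ \sum_{i=1}^5 x_i=1\}$. For $p\in[-1,1]$, the operator $W:S^4\to S^4$, $W(x)=x'$, is defined by $$\begin{aligned} x'_1&=x_5[1+p(x_1-x_2+x_3-x_4)],\\ x'_2&=x_1[1+p(x_2-x_3+x_4-x_5)],\\ x'_3&=x_2[1-p(x_1-x_3+x_4-x_5)],\\ x'_4&=x_3[1+p(x_1-x_2+x_4-x_5)],\\ x'_5&=x_4[1-p(x_1-x_2+x_3-x_5)]. \end{aligned}$$ $W^n$ is the $n$-th iterate of $W$; limit points are subsequential limits. The one-dimensional boundary of $S^4$ is the union of the (closed) one-dimensional edges $\Gamma_I=\{x\in S^4: x_i=0 \text{ for all } i\in I\}$ over $I\subset\{1,\dots,5\}$ with $|I|=3$. *)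

theory Defs
  imports "HOL-Analysis.Analysis"
begin

text \<open>Indices range over the five-element type \<^typ>\<open>5\<close>, in which \<^term>\<open>5 :: 5\<close> and \<^term>\<open>0 :: 5\<close>
  denote the same element; thus \<^term>\<open>1 :: 5\<close> up to \<^term>\<open>5 :: 5\<close> enumerate all coordinates.\<close>

definition S4 :: "(real ^ 5) set" where
  "S4 = {x. (\<forall>i. 0 \<le> x $ i) \<and> (\<Sum>i\<in>UNIV. x $ i) = 1}"

definition W :: "real \<Rightarrow> real ^ 5 \<Rightarrow> real ^ 5" where
  "W p x = vector
    [x $ 5 * (1 + p * (x $ 1 - x $ 2 + x $ 3 - x $ 4)),
     x $ 1 * (1 + p * (x $ 2 - x $ 3 + x $ 4 - x $ 5)),
     x $ 2 * (1 - p * (x $ 1 - x $ 3 + x $ 4 - x $ 5)),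
     x $ 3 * (1 + p * (x $ 1 - x $ 2 + x $ 4 - x $ 5)),
     x $ 4 * (1 - p * (x $ 1 - x $ 2 + x $ 3 - x $ 5))]"

definition edge :: "5 set \<Rightarrow> (real ^ 5) set" where
  "edge I = {x \<in> S4. \<forall>i\<in>I. x $ i = 0}"

definition boundary1 :: "(real ^ 5) set" where
  "boundary1 = (\<Union>I\<in>{I. card I = 3}. edge I)"

definition limit_points :: "(nat \<Rightarrow> 'a::topological_space) \<Rightarrow> 'a set" where
  "limit_points X = {l. \<exists>r. strict_mono r \<and> (X \<circ> r) \<longlonglongrightarrow> l}"

lemma UNIV_5: "(UNIV :: 5 set) = {1, 2, 3, 4, 5}"
proof -
  have "card {1, 2, 3, 4, 5 :: 5} = CARD(5)"
    by simp
  then show ?thesis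
    using card_subset_eq[of "UNIV :: 5 set" "{1, 2, 3, 4, 5 :: 5}"] by simp
qed

lemma vector_5 [simp]:
  fixes a b c d e :: "'a::zero"
  shows "(vector [a, b, c, d, e] :: 'a ^ 5) $ 1 = a"
    and "(vector [a, b, c, d, e] :: 'a ^ 5) $ 2 = b"
    and "(vector [a, b, c, d, e] :: 'a ^ 5) $ 3 = c"
    and "(vector [a, b, c, d, e] :: 'a ^ 5) $ 4 = d"
    and "(vector [a, b, c, d, e] :: 'a ^ 5) $ 5 = e"
  unfolding vector_def by simp_all

lemma S4_iff:
  "x \<in> S4 \<longleftrightarrow> 0 \<le> x $ 1 \<and> 0 \<le> x $ 2 \<and> 0 \<le> x $ 3 \<and> 0 \<le> x $ 4 \<and> 0 \<le> x $ 5 \<and>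
    x $ 1 + x $ 2 + x $ 3 + x $ 4 + x $ 5 = 1"
proof -
  have "(\<forall>i. 0 \<le> x $ i) \<longleftrightarrow> (\<forall>i\<in>{1, 2, 3, 4, 5 :: 5}. 0 \<le> x $ i)"
    using UNIV_5 by blast
  moreover have "(\<Sum>i\<in>UNIV. x $ i) = x $ 1 + x $ 2 + x $ 3 + x $ 4 + x $ 5"
    unfolding UNIV_5 by (simp add: add.assoc)
  ultimately show ?thesis
    unfolding S4_def by simp
qed

lemma W_in_S4:
  assumes p: "p \<in> {-1..1}" and x: "x \<in> S4"
  shows "W p x \<in> S4"
proof -
  have nonneg: "0 \<le> a * (1 + p * t)" if "0 \<le> a" "- 1 \<le> t" "t \<le> 1" for a t :: real
  proof -
    have "\<bar>p * t\<bar> \<le> 1 * 1"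
      unfolding abs_mult using p that by (intro mult_mono) auto
    then show ?thesis
      using that by (intro mult_nonneg_nonneg) auto
  qed
  have nonneg': "0 \<le> a * (1 - p * t)" if "0 \<le> a" "- 1 \<le> t" "t \<le> 1" for a t :: real
    using nonneg[of a "- t"] that by simp
  have x': "0 \<le> x $ 1" "0 \<le> x $ 2" "0 \<le> x $ 3" "0 \<le> x $ 4" "0 \<le> x $ 5"
    "x $ 1 + x $ 2 + x $ 3 + x $ 4 + x $ 5 = 1"
    using x unfolding S4_iff by blast+
  have "0 \<le> W p x $ 1"
    unfolding W_def vector_5 by (rule nonneg) (use x' in linarith)+
  moreover have "0 \<le> W p x $ 2"
    unfolding W_def vector_5 by (rule nonneg) (use x' in linarith)+
  moreover have "0 \<le> W p x $ 3"
    unfolding W_def vector_5 by (rule nonneg') (use x' in linarith)+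
  moreover have "0 \<le> W p x $ 4"
    unfolding W_def vector_5 by (rule nonneg) (use x' in linarith)+
  moreover have "0 \<le> W p x $ 5"
    unfolding W_def vector_5 by (rule nonneg') (use x' in linarith)+
  moreover have "W p x $ 1 + W p x $ 2 + W p x $ 3 + W p x $ 4 + W p x $ 5 =
      x $ 1 + x $ 2 + x $ 3 + x $ 4 + x $ 5"
    unfolding W_def vector_5 by (simp add: algebra_simps)
  ultimately show ?thesis
    using x'(6) unfolding S4_iff by presburger
qed

end

theory Submission
  imports Defs
begin

text \<open>The two zero coordinates of the initial point travel around the cycle \<open>1, \<dots>, 5\<close>, and the
  three positive ones evolve by a planar system: if \<open>(a, b, c)\<close> occupies three cyclically
  consecutive coordinates, then its image under \<open>W p\<close> occupies the next three, with values
  \<open>(a (1 + p (b - c)), b (1 + p (c - a)), c (1 + p (a - b)))\<close>, whatever the position. This is the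
  Volterra map \<open>V\<close> of a rock-paper-scissors game. Passing to subsequences that stay in a fixed
  position transfers both claims to the limit set \<open>L\<close> of a \<open>V\<close>-orbit in the open triangle.

  The limit set lies on the boundary because \<open>a b c\<close> is a strict Lyapunov function. One step
  multiplies it by three factors of sum 3, so by the inequality of the arithmetic and geometric
  means it never grows; hence it is constant on \<open>L\<close>. At a point of \<open>L\<close> where it does not vanish
  the three factors must all be 1, which forces the barycentre; but there \<open>a b c\<close> has its maximum
  \<open>1/27\<close>, which an orbit starting elsewhere cannot approach.

  The limit set is infinite because otherwise it would consist of vertices: \<open>V\<close> maps \<open>L\<close> into
  itself and moves the points of an open side strictly monotonically along that side, so that a
  single point of \<open>L\<close> on an open side produces infinitely many. If \<open>L\<close> contained vertices only, the
  orbit would finally be close to the vertices, and, since \<open>V\<close> fixes them and is continuous, close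
  to a single one. But every vertex is a saddle: near it, one of the small coordinates grows at a
  geometric rate, and it is positive along the orbit.\<close>

section \<open>Limit points of sequences\<close>

lemma limit_points_closed:
  assumes "closed S" and "\<And>n. X n \<in> S" and "l \<in> limit_points X"
  shows "l \<in> S"
proof -
  obtain r :: "nat \<Rightarrow> nat" where "(\<lambda>n. X (r n)) \<longlonglongrightarrow> l"
    using assms(3) unfolding limit_points_def comp_def by blast
  then show ?thesis
    using closed_sequentially[OF assms(1), of "\<lambda>n. X (r n)"] assms(2) by blast
qed

lemma limit_points_orbit_invariant:
  assumes f: "continuous_on UNIV f" and l: "l \<in> limit_points (\<lambda>n. (f ^^ n) x)"
  shows "f l \<in> limit_points (\<lambda>n. (f ^^ n) x)"
proof -
  obtain r :: "nat \<Rightarrow> nat" where r: "strict_mono r" "(\<lambda>n. (f ^^ r n) x) \<longlonglongrightarrow> l"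
    using l unfolding limit_points_def comp_def by blast
  have "(\<lambda>n. f ((f ^^ r n) x)) \<longlonglongrightarrow> f l"
    using continuous_on_tendsto_compose[OF f r(2)] by simp
  then have "((\<lambda>n. (f ^^ n) x) \<circ> (Suc \<circ> r)) \<longlonglongrightarrow> f l"
    by (simp add: comp_def)
  moreover have "strict_mono (Suc \<circ> r)"
    using r(1) by (simp add: strict_mono_def)
  ultimately show ?thesis
    unfolding limit_points_def by blast
qed

text \<open>Otherwise infinitely many terms lie in the compact set \<open>K - U\<close>, and so does one of their limit
  points.\<close>

lemma eventually_in_neighbourhood_of_limit_points:
  fixes X :: "nat \<Rightarrow> 'a::metric_space"
  assumes "compact K" and X: "\<And>n. X n \<in> K" and "open U" and U: "limit_points X \<subseteq> U"
  shows "eventually (\<lambda>n. X n \<in> U) sequentially"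
proof (rule ccontr)
  assume "\<not> ?thesis"
  then have "infinite {n. X n \<notin> U}"
    by (simp add: not_eventually frequently_sequentially infinite_nat_iff_unbounded_le)
  then obtain r :: "nat \<Rightarrow> nat" where r: "strict_mono r" "\<And>n. X (r n) \<notin> U"
    using infinite_enumerate[of "{n. X n \<notin> U}"] by blast
  have "compact (K - U)"
    using assms by (simp add: compact_diff)
  moreover have "\<forall>n. (X \<circ> r) n \<in> K - U"
    using X r by simp
  ultimately obtain l and s :: "nat \<Rightarrow> nat"
    where l: "l \<in> K - U" and s: "strict_mono s" "((X \<circ> r) \<circ> s) \<longlonglongrightarrow> l"
    unfolding compact_def by blast
  have "l \<in> limit_points X"
    unfolding limit_points_def using strict_mono_o[OF r(1) s(1)] s(2) by (auto simp: o_assoc)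
  then show False
    using l U by blast
qed

lemma subsequence_of_constant_colour:
  fixes col :: "nat \<Rightarrow> 'c::finite"
  obtains k and s :: "nat \<Rightarrow> nat" where "strict_mono s" "\<And>n. col (s n) = k"
proof -
  have "\<exists>k\<in>UNIV. infinite {n \<in> UNIV. col n = k}"
    by (rule pigeonhole_infinite_rel) auto
  then obtain k where "infinite {n. col n = k}"
    by auto
  then show ?thesis
    using infinite_enumerate[of "{n. col n = k}"] that by blast
qed

section \<open>The planar Volterra map\<close>

definition V :: "real \<Rightarrow> real \<times> real \<times> real \<Rightarrow> real \<times> real \<times> real" where
  "V p = (\<lambda>(a, b, c). (a * (1 + p * (b - c)), b * (1 + p * (c - a)), c * (1 + p * (a - b))))"

definition closed_triangle :: "(real \<times> real \<times> real) set" where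
  "closed_triangle = {(a, b, c). 0 \<le> a \<and> 0 \<le> b \<and> 0 \<le> c \<and> a + b + c = 1}"

definition open_triangle :: "(real \<times> real \<times> real) set" where
  "open_triangle = {(a, b, c). 0 < a \<and> 0 < b \<and> 0 < c \<and> a + b + c = 1}"

definition rot :: "real \<times> real \<times> real \<Rightarrow> real \<times> real \<times> real" where
  "rot = (\<lambda>(a, b, c). (b, c, a))"

lemma continuous_V: "continuous_on UNIV (V p)"
  unfolding V_def case_prod_unfold by (intro continuous_intros)

lemma V_rot: "V p (rot y) = rot (V p y)"
  by (simp add: V_def rot_def case_prod_unfold)

lemma V_funpow_rot: "(V p ^^ n) (rot y) = rot ((V p ^^ n) y)"
  by (induction n) (simp_all add: V_rot)

lemma rot_image_invariant:
  assumes "V p ` S \<subseteq> S"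
  shows "V p ` rot ` S \<subseteq> rot ` S"
proof -
  have "V p ` rot ` S = rot ` (V p ` S)"
    by (simp add: image_image V_rot)
  also have "\<dots> \<subseteq> rot ` S"
    using assms by (rule image_mono)
  finally show ?thesis .
qed

lemma rot_open_triangle: "y \<in> open_triangle \<Longrightarrow> rot y \<in> open_triangle"
  by (auto simp: open_triangle_def rot_def)

lemma compact_closed_triangle: "compact closed_triangle"
proof -
  have "closed_triangle = ({0..1} \<times> {0..1} \<times> {0..1}) \<inter> {y. fst y + fst (snd y) + snd (snd y) = 1}"
    by (auto simp: closed_triangle_def)
  also have "compact \<dots>"
    by (intro compact_Int_closed compact_Times compact_Icc closed_Collect_eq continuous_intros)
  finally show ?thesis .
qed

lemma open_triangle_subset: "open_triangle \<subseteq> closed_triangle"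
  by (auto simp: closed_triangle_def open_triangle_def)

lemma growth_factor_pos:
  fixes p t :: real
  assumes "p \<in> {-1..1}" "\<bar>t\<bar> < 1"
  shows "0 < 1 + p * t"
proof -
  have "\<bar>p * t\<bar> \<le> 1 * \<bar>t\<bar>"
    unfolding abs_mult using assms by (intro mult_right_mono) auto
  then show ?thesis
    using assms(2) by linarith
qed

lemma V_open_triangle:
  assumes p: "p \<in> {-1..1}" and y: "y \<in> open_triangle"
  shows "V p y \<in> open_triangle"
proof -
  obtain a b c where abc: "y = (a, b, c)" "0 < a" "0 < b" "0 < c" "a + b + c = 1"
    using y by (auto simp: open_triangle_def)
  have "0 < 1 + p * (b - c)" "0 < 1 + p * (c - a)" "0 < 1 + p * (a - b)"
    by (rule growth_factor_pos[OF p]; use abc in linarith)+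
  moreover have "a * (1 + p * (b - c)) + b * (1 + p * (c - a)) + c * (1 + p * (a - b)) = a + b + c"
    by (simp add: algebra_simps)
  ultimately show ?thesis
    using abc by (simp add: V_def open_triangle_def)
qed

lemma V_funpow_open_triangle:
  assumes "p \<in> {-1..1}" and "y \<in> open_triangle"
  shows "(V p ^^ n) y \<in> open_triangle"
  using assms by (induction n) (simp_all add: V_open_triangle)

lemma limit_points_closed_triangle:
  assumes "p \<in> {-1..1}" and "y \<in> open_triangle"
  shows "limit_points (\<lambda>n. (V p ^^ n) y) \<subseteq> closed_triangle"
proof
  fix z
  have "(V p ^^ n) y \<in> closed_triangle" for n
    using V_funpow_open_triangle[OF assms] open_triangle_subset by (rule rev_subsetD)
  then show "z \<in> closed_triangle" if "z \<in> limit_points (\<lambda>n. (V p ^^ n) y)"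
    using limit_points_closed[OF compact_imp_closed[OF compact_closed_triangle] _ that] by simp
qed

section \<open>Limit points lie on the boundary of the triangle\<close>

text \<open>Both summands on the right are nonnegative for \<open>u, v, w \<ge> 0\<close>, and the first one vanishes only if
  \<open>u = v = w\<close>: this gives the inequality together with its case of equality.\<close>

lemma am_gm3_identity:
  fixes u v w :: real
  shows "2 * ((u + v + w) ^ 3 - 27 * (u * v * w)) =
    (u + v + w) * ((u - v)\<^sup>2 + (v - w)\<^sup>2 + (w - u)\<^sup>2) +
    6 * (u * (v - w)\<^sup>2 + v * (w - u)\<^sup>2 + w * (u - v)\<^sup>2)"
  by algebra

lemma am_gm3:
  fixes u v w :: real
  assumes "0 \<le> u" "0 \<le> v" "0 \<le> w"
  shows "27 * (u * v * w) \<le> (u + v + w) ^ 3"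
proof -
  have "0 \<le> 2 * ((u + v + w) ^ 3 - 27 * (u * v * w))"
    unfolding am_gm3_identity using assms by (intro add_nonneg_nonneg mult_nonneg_nonneg) auto
  then show ?thesis
    by simp
qed

lemma am_gm3_equality:
  fixes u v w :: real
  assumes "0 \<le> u" "0 \<le> v" "0 \<le> w" "0 < u + v + w" and eq: "27 * (u * v * w) = (u + v + w) ^ 3"
  shows "u = v" "v = w"
proof -
  define A where "A = (u - v)\<^sup>2 + (v - w)\<^sup>2 + (w - u)\<^sup>2"
  define B where "B = u * (v - w)\<^sup>2 + v * (w - u)\<^sup>2 + w * (u - v)\<^sup>2"
  have "0 \<le> A" "0 \<le> B"
    using assms by (simp_all add: A_def B_def)
  moreover have "(u + v + w) * A + 6 * B = 0"
    using am_gm3_identity[of u v w] unfolding eq A_def B_def by simp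
  ultimately have "A = 0"
    using assms(4) by (simp add: add_nonneg_eq_0_iff)
  then have "(u - v)\<^sup>2 = 0 \<and> (v - w)\<^sup>2 = 0"
    using zero_le_power2[of "u - v"] zero_le_power2[of "v - w"] zero_le_power2[of "w - u"]
    unfolding A_def by linarith
  then show "u = v" "v = w"
    by simp_all
qed

definition prod3 :: "real \<times> real \<times> real \<Rightarrow> real" where
  "prod3 = (\<lambda>(a, b, c). a * b * c)"

lemma continuous_prod3: "continuous_on UNIV prod3"
  unfolding prod3_def case_prod_unfold by (intro continuous_intros)

lemma growth_factor_nonneg:
  fixes p t :: real
  assumes "p \<in> {-1..1}" "\<bar>t\<bar> \<le> 1"
  shows "0 \<le> 1 + p * t"
proof -
  have "\<bar>p * t\<bar> \<le> 1 * 1"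
    unfolding abs_mult using assms by (intro mult_mono) auto
  then show ?thesis
    by linarith
qed

text \<open>One step multiplies \<open>prod3\<close> by three nonnegative growth factors whose sum is 3, hence by at most
  1, and by exactly 1 only if all three factors are 1. As \<open>p \<noteq> 0\<close>, the latter means that the three
  differences \<open>b - c\<close>, \<open>c - a\<close>, \<open>a - b\<close> vanish.\<close>

lemma prod3_V_le:
  assumes p: "p \<in> {-1..1}" and y: "y \<in> closed_triangle"
  shows "prod3 (V p y) \<le> prod3 y"
proof -
  obtain a b c where abc: "y = (a, b, c)" "0 \<le> a" "0 \<le> b" "0 \<le> c" "a + b + c = 1"
    using y by (auto simp: closed_triangle_def)
  define u v w where uvw: "u = 1 + p * (b - c)" "v = 1 + p * (c - a)" "w = 1 + p * (a - b)"
  have "0 \<le> u" "0 \<le> v" "0 \<le> w"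
    unfolding uvw by (rule growth_factor_nonneg[OF p]; use abc in linarith)+
  moreover have "u + v + w = 3"
    by (simp add: uvw algebra_simps)
  ultimately have "u * v * w \<le> 1"
    using am_gm3[of u v w] by simp
  then have "(a * b * c) * (u * v * w) \<le> (a * b * c) * 1"
    using abc by (intro mult_left_mono) auto
  moreover have "prod3 (V p y) = (a * b * c) * (u * v * w)"
    by (simp add: abc prod3_def V_def uvw)
  ultimately show ?thesis
    by (simp add: abc prod3_def)
qed

lemma prod3_V_eq:
  assumes p: "p \<in> {-1..1}" "p \<noteq> 0" and y: "y \<in> closed_triangle"
    and eq: "prod3 (V p y) = prod3 y" and nz: "prod3 y \<noteq> 0"
  shows "prod3 y = 1/27"
proof -
  obtain a b c where abc: "y = (a, b, c)" "0 \<le> a" "0 \<le> b" "0 \<le> c" "a + b + c = 1"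
    using y by (auto simp: closed_triangle_def)
  define u v w where uvw: "u = 1 + p * (b - c)" "v = 1 + p * (c - a)" "w = 1 + p * (a - b)"
  have nonneg: "0 \<le> u" "0 \<le> v" "0 \<le> w"
    unfolding uvw by (rule growth_factor_nonneg[OF p(1)]; use abc in linarith)+
  have sum: "u + v + w = 3"
    by (simp add: uvw algebra_simps)
  have "prod3 (V p y) = prod3 y * (u * v * w)"
    by (simp add: abc prod3_def V_def uvw)
  then have "u * v * w = 1"
    using eq nz by simp
  then have "u = v" "v = w"
    using am_gm3_equality[of u v w] nonneg sum by simp_all
  then have "b - c = c - a" "c - a = a - b"
    using p(2) by (simp_all add: uvw)
  then have third: "a = 1/3" "b = 1/3" "c = 1/3"
    using abc(5) by linarith+
  show ?thesis
    unfolding abc(1) third prod3_def by simp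
qed

text \<open>\<open>prod3\<close> decreases along the orbit, so its limit \<open>m\<close> is the value that it takes at each limit
  point, in particular at both \<open>z\<close> and \<open>V p z\<close>. A nonzero \<open>m\<close> would therefore be \<open>1/27\<close>, which is
  the maximum of \<open>prod3\<close> on the triangle and is attained at the barycentre only; since
  \<open>m \<le> prod3 y\<close>, the orbit would have started there.\<close>

lemma limit_points_prod3_zero:
  assumes p: "p \<in> {-1..1}" "p \<noteq> 0" and y: "y \<in> open_triangle" and y': "y \<noteq> (1/3, 1/3, 1/3)"
    and z: "z \<in> limit_points (\<lambda>n. (V p ^^ n) y)"
  shows "prod3 z = 0"
proof (rule ccontr)
  assume nz: "prod3 z \<noteq> 0"
  let ?Y = "\<lambda>n. (V p ^^ n) y"
  have Y: "?Y n \<in> closed_triangle" for n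
    using V_funpow_open_triangle[OF p(1) y] open_triangle_subset by (rule rev_subsetD)
  have dec: "decseq (\<lambda>n. prod3 (?Y n))"
    unfolding decseq_Suc_iff using prod3_V_le[OF p(1) Y] by simp
  have "\<forall>n. 0 \<le> prod3 (?Y n)"
  proof
    show "0 \<le> prod3 (?Y n)" for n
      using Y[of n] by (auto simp: closed_triangle_def prod3_def)
  qed
  with dec obtain m where m: "(\<lambda>n. prod3 (?Y n)) \<longlonglongrightarrow> m" "\<forall>n. m \<le> prod3 (?Y n)"
    by (rule decseq_convergent)
  have const: "prod3 l = m" if l: "l \<in> limit_points ?Y" for l
  proof -
    obtain r :: "nat \<Rightarrow> nat" where r: "strict_mono r" "(\<lambda>n. ?Y (r n)) \<longlonglongrightarrow> l"
      using l unfolding limit_points_def comp_def by blast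
    have "(\<lambda>n. prod3 (?Y (r n))) \<longlonglongrightarrow> prod3 l"
      using continuous_on_tendsto_compose[OF continuous_prod3 r(2)] by simp
    moreover have "(\<lambda>n. prod3 (?Y (r n))) \<longlonglongrightarrow> m"
      using LIMSEQ_subseq_LIMSEQ[OF m(1) r(1)] by (simp add: comp_def)
    ultimately show ?thesis
      by (rule LIMSEQ_unique)
  qed
  have "prod3 (V p z) = prod3 z"
    using const[OF z] const[OF limit_points_orbit_invariant[OF continuous_V z]] by simp
  then have "prod3 z = 1/27"
    using prod3_V_eq[OF p _ _ nz] limit_points_closed_triangle[OF p(1) y] z by blast
  then have "1/27 \<le> prod3 y"
    using const[OF z] m(2)[rule_format, of 0] by simp
  moreover obtain a b c where abc: "y = (a, b, c)" "0 < a" "0 < b" "0 < c" "a + b + c = 1"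
    using y by (auto simp: open_triangle_def)
  ultimately have "27 * (a * b * c) = (a + b + c) ^ 3"
    using am_gm3[of a b c] by (simp add: prod3_def)
  then have "a = b" "b = c"
    using am_gm3_equality[of a b c] abc by simp_all
  then show False
    using abc y' by simp
qed

section \<open>There are infinitely many limit points\<close>

text \<open>On the side \<open>c = 0\<close> the map is \<open>a \<mapsto> a + p a (1 - a)\<close>, which increases \<open>p a\<close> strictly as long as
  \<open>0 < a < 1\<close> and keeps \<open>a\<close> in that interval. So no point of the open side can have the largest value
  of \<open>p a\<close> among those in \<open>L\<close>.\<close>

lemma finite_invariant_set_side:
  assumes p: "p \<in> {-1..1}" "p \<noteq> 0" and "finite L" and inv: "V p ` L \<subseteq> L"
    and ab: "(a, b, 0) \<in> L" "0 \<le> a" "0 \<le> b" "a + b = 1"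
  shows "a = 0 \<or> b = 0"
proof (rule ccontr)
  assume neg: "\<not> (a = 0 \<or> b = 0)"
  define S where "S = {x. (x, 1 - x, 0) \<in> L \<and> 0 < x \<and> x < 1}"
  have "b = 1 - a" "0 < a" "a < 1"
    using neg ab by auto
  then have "a \<in> S"
    using ab(1) by (simp add: S_def)
  have "finite S"
  proof (rule finite_subset)
    show "S \<subseteq> fst ` L"
      unfolding S_def by force
  qed (use \<open>finite L\<close> in simp)
  have "Max ((*) p ` S) \<in> (*) p ` S"
    using \<open>finite S\<close> \<open>a \<in> S\<close> by (intro Max_in) auto
  then obtain x where x: "x \<in> S" "Max ((*) p ` S) = p * x"
    by blast
  let ?x' = "x * (1 + p * (1 - x))"
  have "0 < x" "x < 1" "(x, 1 - x, 0) \<in> L"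
    using x(1) by (simp_all add: S_def)
  moreover from this have "0 < 1 + p * (1 - x)" "0 < 1 + p * (- x)"
    using growth_factor_pos[OF p(1), of "1 - x"] growth_factor_pos[OF p(1), of "- x"] by simp_all
  moreover have "V p (x, 1 - x, 0) = (?x', 1 - ?x', 0)"
    by (simp add: V_def algebra_simps)
  moreover have "1 - ?x' = (1 - x) * (1 + p * (- x))"
    by (simp add: algebra_simps)
  ultimately have "?x' \<in> S"
    unfolding S_def using inv by (smt (verit) image_subset_iff mem_Collect_eq mult_pos_pos)
  then have "p * ?x' \<le> p * x"
    unfolding x(2)[symmetric] using \<open>finite S\<close> by (intro Max_ge) auto
  moreover have "p * ?x' = p * x + p\<^sup>2 * (x * (1 - x))"
    by (simp add: algebra_simps power2_eq_square)
  moreover have "0 < p\<^sup>2 * (x * (1 - x))"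
    using p(2) \<open>0 < x\<close> \<open>x < 1\<close> by simp
  ultimately show False
    by linarith
qed

text \<open>At the vertex \<open>(1, 0, 0)\<close> the coordinates \<open>b\<close> and \<open>c\<close> are multiplied by \<open>1 - p\<close> and \<open>1 + p\<close>;
  one of these factors exceeds 1, and which one depends on the sign of \<open>p\<close>. The coordinate \<open>g\<close> that
  is repelled in this way would outgrow 1 if the orbit stayed near the vertex: for \<open>a > 4/5\<close> both
  \<open>a - b\<close> and \<open>a - c\<close> exceed \<open>3/5\<close>, so that \<open>q\<close> bounds its growth factor from below.\<close>

lemma vertex_repels:
  assumes p: "p \<in> {-1..1}" "p \<noteq> 0" and y: "y \<in> open_triangle"
  shows "\<not> (\<forall>n. 4/5 < fst ((V p ^^ n) y))"
proof
  assume near: "\<forall>n. 4/5 < fst ((V p ^^ n) y)"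
  define g where "g = (if 0 < p then (\<lambda>y :: real \<times> real \<times> real. snd (snd y)) else (\<lambda>y. fst (snd y)))"
  define q where "q = 1 + 3/5 * \<bar>p\<bar>"
  have "1 < q"
    using p by (simp add: q_def)
  have g: "0 < g x \<and> g x < 1" if "x \<in> open_triangle" for x
    using that by (auto simp: open_triangle_def g_def)
  have step: "q * g x \<le> g (V p x)" if x: "x \<in> open_triangle" "4/5 < fst x" for x
  proof -
    obtain a b c where abc: "x = (a, b, c)" "0 < b" "0 < c" "a + b + c = 1" "4/5 < a"
      using x by (auto simp: open_triangle_def)
    show ?thesis
    proof (cases "0 < p")
      case True
      have "p * (3/5) \<le> p * (a - b)"
        using True abc by (intro mult_left_mono) auto
      then have "c * q \<le> c * (1 + p * (a - b))"
        using True abc by (intro mult_left_mono) (auto simp: q_def)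
      then show ?thesis
        using True abc by (simp add: g_def V_def mult.commute)
    next
      case False
      have "- p * (3/5) \<le> - p * (a - c)"
        using False abc by (intro mult_left_mono) auto
      then have "b * q \<le> b * (1 + p * (c - a))"
        using False abc by (intro mult_left_mono) (auto simp: q_def algebra_simps)
      then show ?thesis
        using False abc by (simp add: g_def V_def mult.commute)
    qed
  qed
  have "q ^ n * g y \<le> g ((V p ^^ n) y)" for n
  proof (induction n)
    case (Suc n)
    have "q ^ Suc n * g y \<le> q * g ((V p ^^ n) y)"
      using Suc \<open>1 < q\<close> by (simp add: mult.assoc)
    also have "\<dots> \<le> g (V p ((V p ^^ n) y))"
      using step V_funpow_open_triangle[OF p(1) y] near by blast
    finally show ?case
      by simp
  qed simp
  moreover obtain n where "1 / g y < q ^ n"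
    using real_arch_pow[OF \<open>1 < q\<close>] by blast
  ultimately have "1 < g ((V p ^^ n) y)"
    using g[OF y] by (smt (verit) divide_less_eq)
  then show False
    using g[OF V_funpow_open_triangle[OF p(1) y, of n]] by simp
qed

text \<open>Near a vertex the map moves points only a little, so that an orbit that is close to some vertex
  at every time cannot jump from one to another. With the threshold \<open>4/5\<close>, one step leaves the large
  coordinate above \<open>(4/5)\<^sup>2 > 3/5\<close>, hence the other two below \<open>2/5\<close>.\<close>

lemma vertex_neighbourhood_trapping:
  assumes p: "p \<in> {-1..1}" and y: "y \<in> open_triangle" "4/5 < fst y"
    and near: "4/5 < fst (V p y) \<or> 4/5 < fst (snd (V p y)) \<or> 4/5 < snd (snd (V p y))"
  shows "4/5 < fst (V p y)"
proof -
  obtain a b c where abc: "y = (a, b, c)" "0 < b" "0 < c" "a + b + c = 1" "4/5 < a"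
    using y by (auto simp: open_triangle_def)
  have "\<bar>b - c\<bar> \<le> 1/5"
    using abc by linarith
  then have "\<bar>p * (b - c)\<bar> \<le> 1 * (1/5)"
    unfolding abs_mult using p by (intro mult_mono) auto
  then have "4/5 * (4/5) \<le> a * (1 + p * (b - c))"
    using abc by (intro mult_mono) auto
  then have "3/5 < fst (V p y)"
    by (simp add: abc V_def)
  moreover have "V p y \<in> open_triangle"
    using V_open_triangle[OF p y(1)] .
  ultimately show ?thesis
    using near by (auto simp: open_triangle_def)
qed

lemma not_always_near_vertices:
  assumes p: "p \<in> {-1..1}" "p \<noteq> 0" and y: "y \<in> open_triangle"
    and near: "\<And>n. 4/5 < fst ((V p ^^ n) y) \<or> 4/5 < fst (snd ((V p ^^ n) y)) \<or>
      4/5 < snd (snd ((V p ^^ n) y))"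
  shows False
proof -
  have not_first: "\<not> 4/5 < fst y"
    if y: "y \<in> open_triangle"
      and near: "\<And>n. 4/5 < fst ((V p ^^ n) y) \<or> 4/5 < fst (snd ((V p ^^ n) y)) \<or>
        4/5 < snd (snd ((V p ^^ n) y))" for y
  proof
    assume first: "4/5 < fst y"
    have "4/5 < fst ((V p ^^ n) y)" for n
    proof (induction n)
      case (Suc n)
      then show ?case
        using vertex_neighbourhood_trapping[OF p(1) V_funpow_open_triangle[OF p(1) y, of n]]
          near[of "Suc n"] by simp
    qed (use first in simp)
    then show False
      using vertex_repels[OF p y] by blast
  qed
  have rot: "fst (rot x) = fst (snd x)" "fst (snd (rot x)) = snd (snd x)" "snd (snd (rot x)) = fst x"
    for x
    by (simp_all add: rot_def case_prod_unfold)
  have "\<not> 4/5 < fst y"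
    using not_first[OF y near] .
  moreover have "\<not> 4/5 < fst (rot y)"
    by (rule not_first) (use rot_open_triangle[OF y] near in \<open>auto simp: V_funpow_rot rot\<close>)
  moreover have "\<not> 4/5 < fst (rot (rot y))"
    by (rule not_first)
      (use rot_open_triangle[OF rot_open_triangle[OF y]] near in \<open>auto simp: V_funpow_rot rot\<close>)
  ultimately show False
    using near[of 0] by (simp add: rot)
qed

text \<open>The sides \<open>a = 0\<close> and \<open>b = 0\<close> are reduced to the side \<open>c = 0\<close> by rotating the limit set.\<close>

lemma infinite_limit_points_V:
  assumes p: "p \<in> {-1..1}" "p \<noteq> 0" and y: "y \<in> open_triangle" and y': "y \<noteq> (1/3, 1/3, 1/3)"
  shows "infinite (limit_points (\<lambda>n. (V p ^^ n) y))"
proof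
  let ?Y = "\<lambda>n. (V p ^^ n) y"
  let ?L = "limit_points ?Y"
  assume fin: "finite ?L"
  have inv: "V p ` ?L \<subseteq> ?L"
    using limit_points_orbit_invariant[OF continuous_V] by blast
  have inv': "V p ` (rot ` ?L) \<subseteq> rot ` ?L"
    using inv by (rule rot_image_invariant)
  have inv'': "V p ` (rot ` rot ` ?L) \<subseteq> rot ` rot ` ?L"
    using inv' by (rule rot_image_invariant)
  have vertex: "z \<in> {(1, 0, 0), (0, 1, 0), (0, 0, 1)}" if z: "z \<in> ?L" for z
  proof -
    obtain a b c where abc: "z = (a, b, c)" "0 \<le> a" "0 \<le> b" "0 \<le> c" "a + b + c = 1"
      using limit_points_closed_triangle[OF p(1) y] z by (auto simp: closed_triangle_def)
    have "a = 0 \<or> b = 0 \<or> c = 0"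
      using limit_points_prod3_zero[OF p y y' z] by (auto simp: prod3_def abc)
    moreover have "a = 0 \<or> b = 0" if "c = 0"
      by (rule finite_invariant_set_side[OF p fin inv]) (use that z abc in auto)
    moreover have "b = 0 \<or> c = 0" if "a = 0"
    proof (rule finite_invariant_set_side[OF p _ inv'])
      show "(b, c, 0) \<in> rot ` ?L"
        using z that by (force simp: rot_def abc)
    qed (use fin abc that in auto)
    moreover have "c = 0 \<or> a = 0" if "b = 0"
    proof (rule finite_invariant_set_side[OF p _ inv''])
      show "(c, a, 0) \<in> rot ` rot ` ?L"
        using z that by (force simp: rot_def abc)
    qed (use fin abc that in auto)
    ultimately show ?thesis
      using abc by auto
  qed
  define U where "U = {x :: real \<times> real \<times> real. 4/5 < fst x \<or> 4/5 < fst (snd x) \<or> 4/5 < snd (snd x)}"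
  have U: "open U"
    unfolding U_def by (intro open_Collect_disj open_Collect_less continuous_intros)
  have L: "?L \<subseteq> U"
    using vertex by (fastforce simp: U_def)
  have Y: "?Y n \<in> closed_triangle" for n
    using V_funpow_open_triangle[OF p(1) y] open_triangle_subset by (rule rev_subsetD)
  have "eventually (\<lambda>n. ?Y n \<in> U) sequentially"
    by (rule eventually_in_neighbourhood_of_limit_points[OF compact_closed_triangle Y U L])
  then obtain N where "\<And>n. N \<le> n \<Longrightarrow> ?Y n \<in> U"
    unfolding eventually_sequentially by blast
  then have "(V p ^^ n) (?Y N) \<in> U" for n
    by (metis le_add2 comp_apply funpow_add)
  then show False
    using not_always_near_vertices[OF p V_funpow_open_triangle[OF p(1) y, of N]]
    unfolding U_def by blast
qed

section \<open>Three consecutive coordinates on the cycle\<close>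

text \<open>The arithmetic of the index type \<open>5\<close> is modulo 5, so that \<open>k + 1\<close>, \<open>k + 2\<close>, \<open>k + 3\<close> are cyclically
  consecutive for every \<open>k\<close>.\<close>

definition place :: "5 \<Rightarrow> real \<times> real \<times> real \<Rightarrow> real ^ 5" where
  "place k = (\<lambda>(a, b, c).
    \<chi> i. if i = k + 1 then a else if i = k + 2 then b else if i = k + 3 then c else 0)"

lemma place_nth:
  "place k (a, b, c) $ (k + 1) = a" "place k (a, b, c) $ (k + 2) = b"
  "place k (a, b, c) $ (k + 3) = c" "place k (a, b, c) $ (k + 4) = 0" "place k (a, b, c) $ k = 0"
  by (simp_all add: place_def)

lemma continuous_place: "continuous_on UNIV (place k)"
proof -
  have "continuous_on UNIV (\<lambda>y. place k y $ i)" for i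
    unfolding place_def case_prod_unfold vec_lambda_beta
    by (cases "i = k + 1"; cases "i = k + 2"; cases "i = k + 3") (auto intro!: continuous_intros)
  then have "continuous_on UNIV (\<lambda>y. \<chi> i. place k y $ i)"
    by (rule continuous_on_vec_lambda)
  then show ?thesis
    by simp
qed

lemma inj_place: "inj (place k)"
proof (rule injI)
  fix y y'
  assume "place k y = place k y'"
  then show "y = y'"
    by (cases y, cases y') (metis place_nth(1-3))
qed

text \<open>The signs in the five rows of \<open>W p\<close> are arranged so that \<open>W p\<close> commutes with the cyclic shift of
  the coordinates. This is why the same map \<open>V p\<close> appears at every position \<open>k\<close>.\<close>

lemma W_place: "W p (place k y) = place (k + 1) (V p y)"
proof -
  obtain a b c where y: "y = (a, b, c)"
    by (rule prod_cases3)
  have "k \<in> {1, 2, 3, 4, 5}"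
    using UNIV_5 by blast
  then have "W p (place k y) $ i = place (k + 1) (V p y) $ i" if "i \<in> {1, 2, 3, 4, 5}" for i
    using that unfolding y V_def W_def place_def 
    by (elim insertE emptyE) (simp_all add: algebra_simps)
  then show ?thesis
    unfolding vec_eq_iff using UNIV_5 by blast
qed

lemma W_funpow_place: "(W p ^^ n) (place 0 y) = place (of_nat n) ((V p ^^ n) y)"
  by (induction n) (simp_all add: W_place add.commute)

text \<open>The position at time \<open>n\<close> is \<open>n\<close> modulo 5, so it is constant along a suitable subsequence of any
  subsequence. There the large sequence converges if and only if the planar one does, since \<open>place k\<close>
  is continuous and so is the projection that inverts it.\<close>

lemma limit_point_W_position:
  assumes "l \<in> limit_points (\<lambda>n. place (of_nat n) (Y n))"
  obtains k z where "z \<in> limit_points Y" "l = place k z"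
proof -
  obtain r :: "nat \<Rightarrow> nat" where r: "strict_mono r" "(\<lambda>n. place (of_nat (r n)) (Y (r n))) \<longlonglongrightarrow> l"
    using assms unfolding limit_points_def comp_def by blast
  obtain k :: 5 and s :: "nat \<Rightarrow> nat" where s: "strict_mono s" "\<And>n. of_nat (r (s n)) = k"
    using subsequence_of_constant_colour[of "\<lambda>n. of_nat (r n) :: 5"] by blast
  have lim: "(\<lambda>n. place k (Y (r (s n)))) \<longlonglongrightarrow> l"
    using LIMSEQ_subseq_LIMSEQ[OF r(2) s(1)] by (simp add: comp_def s(2))
  define proj where "proj = (\<lambda>x :: real ^ 5. (x $ (k + 1), x $ (k + 2), x $ (k + 3)))"
  have proj: "proj (place k y) = y" for y
    by (cases y) (simp add: proj_def place_nth)
  have "(\<lambda>n. proj (place k (Y (r (s n))))) \<longlonglongrightarrow> proj l"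
    unfolding proj_def by (intro tendsto_intros lim)
  then have lim': "(\<lambda>n. Y (r (s n))) \<longlonglongrightarrow> proj l"
    by (simp add: proj)
  then have "proj l \<in> limit_points Y"
    unfolding limit_points_def using strict_mono_o[OF r(1) s(1)] by (auto simp: comp_def)
  moreover have "l = place k (proj l)"
    using LIMSEQ_unique[OF lim] continuous_on_tendsto_compose[OF continuous_place lim'] by simp
  ultimately show ?thesis
    by (rule that)
qed

lemma limit_point_V_position:
  assumes "z \<in> limit_points Y"
  obtains k where "place k z \<in> limit_points (\<lambda>n. place (of_nat n) (Y n))"
proof -
  obtain r :: "nat \<Rightarrow> nat" where r: "strict_mono r" "(\<lambda>n. Y (r n)) \<longlonglongrightarrow> z"
    using assms unfolding limit_points_def comp_def by blast
  obtain k :: 5 and s :: "nat \<Rightarrow> nat" where s: "strict_mono s" "\<And>n. of_nat (r (s n)) = k"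
    using subsequence_of_constant_colour[of "\<lambda>n. of_nat (r n) :: 5"] by blast
  have "(\<lambda>n. Y (r (s n))) \<longlonglongrightarrow> z"
    using LIMSEQ_subseq_LIMSEQ[OF r(2) s(1)] by (simp add: comp_def)
  then have "(\<lambda>n. place k (Y (r (s n)))) \<longlonglongrightarrow> place k z"
    using continuous_on_tendsto_compose[OF continuous_place] by fastforce
  then have "place k z \<in> limit_points (\<lambda>n. place (of_nat n) (Y n))"
    unfolding limit_points_def using strict_mono_o[OF r(1) s(1)]
    by (auto simp: comp_def s(2) intro!: exI[of _ "r \<circ> s"])
  then show ?thesis
    by (rule that)
qed

lemma infinite_limit_points_place:
  assumes "infinite (limit_points Y)"
  shows "infinite (limit_points (\<lambda>n. place (of_nat n) (Y n)))"
proof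
  let ?L = "limit_points (\<lambda>n. place (of_nat n) (Y n))"
  assume "finite ?L"
  then have "finite (\<Union>k. place k -` ?L)"
    by (intro finite_UN_I finite_vimageI inj_place) auto
  moreover have "limit_points Y \<subseteq> (\<Union>k. place k -` ?L)"
  proof
    fix z
    assume "z \<in> limit_points Y"
    then obtain k where "place k z \<in> ?L"
      by (rule limit_point_V_position)
    then show "z \<in> (\<Union>k. place k -` ?L)"
      by blast
  qed
  ultimately show False
    using assms infinite_super by blast
qed

lemma place_in_boundary1:
  assumes z: "z \<in> closed_triangle" and prod: "prod3 z = 0"
  shows "place k z \<in> boundary1"
proof -
  obtain a b c where abc: "z = (a, b, c)" "0 \<le> a" "0 \<le> b" "0 \<le> c" "a + b + c = 1"
    using z by (auto simp: closed_triangle_def)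
  have k: "k \<in> {1, 2, 3, 4, 5}"
    using UNIV_5 by blast
  have S4: "place k z \<in> S4"
  proof -
    have "(\<Sum>i\<in>UNIV. place k z $ i) = a + b + c"
      using k unfolding abc(1) place_def UNIV_5
      by (elim insertE emptyE) simp_all
    then show ?thesis
      unfolding S4_def using abc by (auto simp: place_def)
  qed
  obtain j where j: "j \<in> {k + 1, k + 2, k + 3}" "place k z $ j = 0"
  proof -
    have "a = 0 \<or> b = 0 \<or> c = 0"
      using prod by (simp add: abc(1) prod3_def)
    then show ?thesis
      using that[of "k + 1"] that[of "k + 2"] that[of "k + 3"] place_nth(1-3)[of k a b c]
      unfolding abc(1) by auto
  qed
  then have "place k z \<in> edge {k, k + 4, j}"
    unfolding edge_def using S4 by (auto simp: abc place_nth)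
  moreover have "card {k, k + 4, j} = 3"
    using j(1) by auto
  ultimately show ?thesis
    unfolding boundary1_def by blast
qed

section \<open>The limit set\<close>

theorem theorem2:
  fixes p x1 x2 :: real and x0 :: "real ^ 5"
  assumes "p \<in> {-1..1}" and "p \<noteq> 0"
    and "x0 = vector [x1, x2, 1 - x1 - x2, 0, 0]"
    and "x0 \<in> S4"
    and "x1 \<noteq> 0" and "x2 \<noteq> 0" and "1 - x1 - x2 \<noteq> 0"
    and "(x1, x2, 1 - x1 - x2) \<noteq> (1/3, 1/3, 1/3)"
  shows "infinite (limit_points (\<lambda>n. (W p ^^ n) x0)) \<and>
    limit_points (\<lambda>n. (W p ^^ n) x0) \<subseteq> boundary1"
proof -
  define y where "y = (x1, x2, 1 - x1 - x2)"
  have y: "y \<in> open_triangle"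
    using assms(4-7) unfolding assms(3) S4_iff by (simp add: y_def open_triangle_def)
  have y': "y \<noteq> (1/3, 1/3, 1/3)"
    using assms(8) by (simp add: y_def)
  have x0: "x0 = place 0 y"
  proof -
    have "x0 $ i = place 0 y $ i" if "i \<in> {1, 2, 3, 4, 5}" for i
      using that by (auto simp: assms(3) y_def place_def)
    then show ?thesis
      unfolding vec_eq_iff using UNIV_5 by blast
  qed
  let ?Y = "\<lambda>n. (V p ^^ n) y"
  have orbit: "(\<lambda>n. (W p ^^ n) x0) = (\<lambda>n. place (of_nat n) (?Y n))"
    by (simp add: x0 W_funpow_place)
  have "infinite (limit_points (\<lambda>n. (W p ^^ n) x0))"
    unfolding orbit
    by (intro infinite_limit_points_place infinite_limit_points_V assms(1,2) y y')
  moreover have "limit_points (\<lambda>n. (W p ^^ n) x0) \<subseteq> boundary1"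
  proof
    fix l
    assume "l \<in> limit_points (\<lambda>n. (W p ^^ n) x0)"
    then obtain k z where "z \<in> limit_points ?Y" "l = place k z"
      unfolding orbit by (rule limit_point_W_position)
    then show "l \<in> boundary1"
      using place_in_boundary1 limit_points_prod3_zero[OF assms(1,2) y y']
        limit_points_closed_triangle[OF assms(1) y] by blast
  qed
  ultimately show ?thesis
    by blast
qed

end
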